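(* Let $(\mathfrak n,J)$ be a real $2n$-dimensional nilpotent Lie algebra endowed with a bi-invariant complex structure $J$. For any Hermitian metric $\langle\cdot,\cdot\rangle$ on $(\mathfrak n,J)$, the following conditions are equivalent: (i) $(\mathfrak n,J,\langle\cdot,\cdot\rangle)$ is minimal. (ii) $(\mathfrak n,\langle\cdot,\cdot\rangle)$ is a nilsoliton. If in addition the complex Lie algebra $\mathfrak n_{\mathbb C}=(\mathfrak n,J)$ is the complexification of an $n$-dimensional real Lie algebra $\mathfrak n_{\mathbb R}$, then a third equivalence holds: (iii) $(\mathfrak n_{\mathbb R},\langle\cdot,\cdot\rangle_{\mathbb R})$ is a nilsoliton, where $\langle\cdot,\cdot\rangle_{\mathbb R}:=\langle\cdot,\cdot\rangle|_{\mathfrak n_{\mathbb R}\times\mathfrak n_{\mathbb R}}$. Furthermore, assume that $\mathfrak n$ is $2$-step nilpotent and consider the Lie algebra $\overline{\mathfrak n}$ conjugate to $\mathfrak n$. Then (i) and (ii) (and also (iii), assuming that $\mathfrak n_{\mathbb C}=\mathfrak n_{\mathbb R}\otimes\mathbb C$) are equivalent to the following conditions: (iv) $(\overline{\mathfrak n},J,\langle\cdot,\cdot\rangle)$ is minimal. (v) $(\overline{\mathfrak n},\langle\cdot,\cdot\rangle)$ is a nilsoliton.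
   Context: A complex structure $J$ on a Lie algebra is bi-invariant if $J^2=-I$ and $[JX,Y]=J[X,Y]$ for all $X,Y$. Given $J$ with $J^2=-I$ on a Lie algebra, an (almost) Hermitian metric is an inner product for which $J$ is orthogonal. $\mathfrak n_{\mathbb C}$ denotes $\mathfrak n$ regarded as a complex Lie algebra, with multiplication by $\sqrt{-1}$ given by $J$. For an inner product $\langle\cdot,\cdot\rangle$ on a real nilpotent Lie algebra, $\mathrm{Ric}_{\langle\cdot,\cdot\rangle}$ denotes the Ricci operator of the corresponding left-invariant metric on the simply connected group, i.e. $\langle\mathrm{Ric}\,X,Y\rangle=-\frac12\sum_{i,j}\langle[X,X_i],X_j\rangle\langle[Y,X_i],X_j\rangle+\frac14\sum_{i,j}\langle[X_i,X_j],X\rangle\langle[X_i,X_j],Y\rangle$ for any orthonormal basis $\{X_i\}$. A nilpotent Lie algebra with inner product $(\mathfrak m,\langle\cdot,\cdot\rangle)$ is a nilsoliton if $\mathrm{Ric}_{\langle\cdot,\cdot\rangle}=cI+D$ for some $c\in\mathbb R$ and some derivation $D$ of $\mathfrak m$. For an almost complex structure $J$ on $\mathfrak m$ and an almost Hermitian metric $\langle\cdot,\cdot\rangle$, $(\mathfrak m,J,\langle\cdot,\cdot\rangle)$ is minimal if $\mathrm{Ric}^J_{\langle\cdot,\cdot\rangle}=cI+D$ for some $c\in\mathbb R$ and some derivation $D$ of $\mathfrak m$, where $\mathrm{Ric}^J:=\frac12(\mathrm{Ric}-J\,\mathrm{Ric}\,J)$ is the $(1,1)$-component of the Ricci operator.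 A Lie algebra $\mathfrak n$ is $2$-step nilpotent if $[\mathfrak n,[\mathfrak n,\mathfrak n]]=0$. Conjugate Lie algebra: for $\mathfrak n$ $2$-step nilpotent with bi-invariant $J$, fix a $J$-invariant direct sum decomposition $\mathfrak n=W_1\oplus W_2$ with $[W_1,W_1]\subset W_2$ and $[\mathfrak n,W_2]=0$, and decompositions $W_k=W_k^{\mathbb R}\oplus W_k^{i\mathbb R}$ ($k=1,2$) with respect to which $J|_{W_k}$ has matrix $\begin{pmatrix}0&-I\\ I&0\end{pmatrix}$. Let $\varphi$ be the linear map equal to $I$ on $W_1^{\mathbb R}$, $-I$ on $W_1^{i\mathbb R}$ and $I$ on $W_2$. Then $\overline{\mathfrak n}$ is the vector space $\mathfrak n$ with the Lie bracket $[X,Y]^-:=[\varphi X,\varphi Y]$; it satisfies $[JX,Y]^-=-J[X,Y]^-$.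
   Formalization: The equivalence with (iii) is stated for real forms orthogonal to their image under J; linking (iv), (v) to (i)–(iii) assumes W_1 orthogonal to W_2 and W_1^R orthogonal to W_1^{iR}. Without these the claims fail, e.g. on the complexified sum of two Heisenberg algebras. *)

theory Defs
  imports "HOL-Analysis.Analysis"
begin

text \<open>
  A Lie algebra is a finite-dimensional subspace \<open>V\<close> of a real vector space together with a
  bracket \<open>br\<close>. Only the values of brackets, inner products and endomorphisms on \<open>V\<close> matter;
  hence a subalgebra \<open>U\<close> of \<open>(V, br)\<close> with the restricted inner product is written with the
  same \<open>br\<close> and \<open>g\<close>, and \<open>V\<close> with another bracket is written with the same \<open>V\<close>.
\<close>

definition linear_endo :: "'a::real_vector set \<Rightarrow> ('a \<Rightarrow> 'a) \<Rightarrow> bool" where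
  "linear_endo V f \<longleftrightarrow>
     (\<forall>x\<in>V. f x \<in> V) \<and>
     (\<forall>x\<in>V. \<forall>y\<in>V. f (x + y) = f x + f y) \<and>
     (\<forall>c. \<forall>x\<in>V. f (c *\<^sub>R x) = c *\<^sub>R f x)"

definition lie_algebra_on :: "'a::real_vector set \<Rightarrow> ('a \<Rightarrow> 'a \<Rightarrow> 'a) \<Rightarrow> bool" where
  "lie_algebra_on V br \<longleftrightarrow>
     subspace V \<and> (\<exists>S. finite S \<and> V = span S) \<and>
     (\<forall>x\<in>V. linear_endo V (br x)) \<and>
     (\<forall>y\<in>V. linear_endo V (\<lambda>x. br x y)) \<and>
     (\<forall>x\<in>V. br x x = 0) \<and>
     (\<forall>x\<in>V. \<forall>y\<in>V. \<forall>z\<in>V. br x (br y z) + br y (br z x) + br z (br x y) = 0)"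

definition bracket_span :: "('a::real_vector \<Rightarrow> 'a \<Rightarrow> 'a) \<Rightarrow> 'a set \<Rightarrow> 'a set \<Rightarrow> 'a set" where
  "bracket_span br A B = span {br x y | x y. x \<in> A \<and> y \<in> B}"

fun lower_central :: "'a::real_vector set \<Rightarrow> ('a \<Rightarrow> 'a \<Rightarrow> 'a) \<Rightarrow> nat \<Rightarrow> 'a set" where
  "lower_central V br 0 = V"
| "lower_central V br (Suc k) = bracket_span br V (lower_central V br k)"

definition nilpotent_lie_algebra :: "'a::real_vector set \<Rightarrow> ('a \<Rightarrow> 'a \<Rightarrow> 'a) \<Rightarrow> bool" where
  "nilpotent_lie_algebra V br \<longleftrightarrow>
     lie_algebra_on V br \<and> (\<exists>k. lower_central V br k = {0})"

definition two_step_nilpotent :: "'a::real_vector set \<Rightarrow> ('a \<Rightarrow> 'a \<Rightarrow> 'a) \<Rightarrow> bool" where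
  "two_step_nilpotent V br \<longleftrightarrow>
     lie_algebra_on V br \<and> bracket_span br V (bracket_span br V V) = {0}"

definition derivation_on ::
  "'a::real_vector set \<Rightarrow> ('a \<Rightarrow> 'a \<Rightarrow> 'a) \<Rightarrow> ('a \<Rightarrow> 'a) \<Rightarrow> bool" where
  "derivation_on V br D \<longleftrightarrow>
     linear_endo V D \<and> (\<forall>x\<in>V. \<forall>y\<in>V. D (br x y) = br (D x) y + br x (D y))"

definition inner_product_on :: "'a::real_vector set \<Rightarrow> ('a \<Rightarrow> 'a \<Rightarrow> real) \<Rightarrow> bool" where
  "inner_product_on V g \<longleftrightarrow>
     (\<forall>x\<in>V. \<forall>y\<in>V. g x y = g y x) \<and>
     (\<forall>x\<in>V. \<forall>y\<in>V. \<forall>z\<in>V. g (x + y) z = g x z + g y z) \<and>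
     (\<forall>c. \<forall>x\<in>V. \<forall>y\<in>V. g (c *\<^sub>R x) y = c * g x y) \<and>
     (\<forall>x\<in>V. x \<noteq> 0 \<longrightarrow> g x x > 0)"

definition orthogonal_sets ::
  "('a::real_vector \<Rightarrow> 'a \<Rightarrow> real) \<Rightarrow> 'a set \<Rightarrow> 'a set \<Rightarrow> bool" where
  "orthogonal_sets g A B \<longleftrightarrow> (\<forall>x\<in>A. \<forall>y\<in>B. g x y = 0)"

definition orthonormal_basis_of ::
  "'a::real_vector set \<Rightarrow> ('a \<Rightarrow> 'a \<Rightarrow> real) \<Rightarrow> 'a set \<Rightarrow> bool" where
  "orthonormal_basis_of V g B \<longleftrightarrow>
     finite B \<and> span B = V \<and> (\<forall>x\<in>B. \<forall>y\<in>B. g x y = (if x = y then 1 else 0))"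

definition ricci_form ::
  "'a set \<Rightarrow> ('a::real_vector \<Rightarrow> 'a \<Rightarrow> 'a) \<Rightarrow> ('a \<Rightarrow> 'a \<Rightarrow> real) \<Rightarrow> 'a \<Rightarrow> 'a \<Rightarrow> real" where
  "ricci_form B br g x y =
     - (1/2) * (\<Sum>a\<in>B. \<Sum>b\<in>B. g (br x a) b * g (br y a) b)
     + (1/4) * (\<Sum>a\<in>B. \<Sum>b\<in>B. g (br a b) x * g (br a b) y)"

text \<open>
  The value of \<^term>\<open>ricci_form B br g x y\<close> is the same for all orthonormal bases \<open>B\<close> of \<open>V\<close>,
  so the following description is proper for \<open>x \<in> V\<close>.
\<close>

definition ricci ::
  "'a::real_vector set \<Rightarrow> ('a \<Rightarrow> 'a \<Rightarrow> 'a) \<Rightarrow> ('a \<Rightarrow> 'a \<Rightarrow> real) \<Rightarrow> 'a \<Rightarrow> 'a" where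
  "ricci V br g x =
     (THE r. r \<in> V \<and>
        (\<forall>B. orthonormal_basis_of V g B \<longrightarrow> (\<forall>y\<in>V. g r y = ricci_form B br g x y)))"

definition nilsoliton ::
  "'a::real_vector set \<Rightarrow> ('a \<Rightarrow> 'a \<Rightarrow> 'a) \<Rightarrow> ('a \<Rightarrow> 'a \<Rightarrow> real) \<Rightarrow> bool" where
  "nilsoliton V br g \<longleftrightarrow>
     nilpotent_lie_algebra V br \<and> inner_product_on V g \<and>
     (\<exists>c D. derivation_on V br D \<and> (\<forall>x\<in>V. ricci V br g x = c *\<^sub>R x + D x))"

definition almost_complex_on :: "'a::real_vector set \<Rightarrow> ('a \<Rightarrow> 'a) \<Rightarrow> bool" where
  "almost_complex_on V J \<longleftrightarrow> linear_endo V J \<and> (\<forall>x\<in>V. J (J x) = - x)"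

definition bi_invariant_complex ::
  "'a::real_vector set \<Rightarrow> ('a \<Rightarrow> 'a \<Rightarrow> 'a) \<Rightarrow> ('a \<Rightarrow> 'a) \<Rightarrow> bool" where
  "bi_invariant_complex V br J \<longleftrightarrow>
     almost_complex_on V J \<and> (\<forall>x\<in>V. \<forall>y\<in>V. br (J x) y = J (br x y))"

definition hermitian_metric ::
  "'a::real_vector set \<Rightarrow> ('a \<Rightarrow> 'a) \<Rightarrow> ('a \<Rightarrow> 'a \<Rightarrow> real) \<Rightarrow> bool" where
  "hermitian_metric V J g \<longleftrightarrow>
     inner_product_on V g \<and> (\<forall>x\<in>V. \<forall>y\<in>V. g (J x) (J y) = g x y)"

definition ricciJ ::
  "'a::real_vector set \<Rightarrow> ('a \<Rightarrow> 'a \<Rightarrow> 'a) \<Rightarrow> ('a \<Rightarrow> 'a) \<Rightarrow> ('a \<Rightarrow> 'a \<Rightarrow> real) \<Rightarrow> 'a \<Rightarrow> 'a" where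
  "ricciJ V br J g x = (1/2) *\<^sub>R (ricci V br g x - J (ricci V br g (J x)))"

definition minimal_metric ::
  "'a::real_vector set \<Rightarrow> ('a \<Rightarrow> 'a \<Rightarrow> 'a) \<Rightarrow> ('a \<Rightarrow> 'a) \<Rightarrow> ('a \<Rightarrow> 'a \<Rightarrow> real) \<Rightarrow> bool" where
  "minimal_metric V br J g \<longleftrightarrow>
     nilpotent_lie_algebra V br \<and> almost_complex_on V J \<and> hermitian_metric V J g \<and>
     (\<exists>c D. derivation_on V br D \<and> (\<forall>x\<in>V. ricciJ V br J g x = c *\<^sub>R x + D x))"

definition direct_sum_of ::
  "'a::real_vector set \<Rightarrow> 'a set \<Rightarrow> 'a set \<Rightarrow> bool" where
  "direct_sum_of V A B \<longleftrightarrow>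
     subspace A \<and> subspace B \<and> A \<inter> B = {0} \<and> V = {a + b | a b. a \<in> A \<and> b \<in> B}"

text \<open>
  \<open>(V, J)\<close> is the complexification of the real subalgebra \<open>U\<close>. For bi-invariant \<open>J\<close> the bracket
  of \<open>V = U \<oplus> J U\<close> is then the complex bilinear extension of the bracket of \<open>U\<close>.
\<close>

definition complexification_of ::
  "'a::real_vector set \<Rightarrow> ('a \<Rightarrow> 'a \<Rightarrow> 'a) \<Rightarrow> ('a \<Rightarrow> 'a) \<Rightarrow> 'a set \<Rightarrow> bool" where
  "complexification_of V br J U \<longleftrightarrow>
     lie_algebra_on U br \<and> direct_sum_of V U (J ` U)"

text \<open>
  For \<open>J\<close> with square \<open>- I\<close>, the restriction of \<open>J\<close> to \<open>W = R \<oplus> I\<close> has block matrix with rows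
  \<open>(0, - I)\<close> and \<open>(I, 0)\<close> in suitable bases of \<open>R\<close> and \<open>I\<close> (namely some basis of \<open>R\<close> and its
  image under \<open>J\<close>) exactly when \<open>J\<close> carries \<open>R\<close> onto \<open>I\<close>.
\<close>

definition conjugate_decomposition ::
  "'a::real_vector set \<Rightarrow> ('a \<Rightarrow> 'a \<Rightarrow> 'a) \<Rightarrow> ('a \<Rightarrow> 'a) \<Rightarrow>
   'a set \<Rightarrow> 'a set \<Rightarrow> 'a set \<Rightarrow> 'a set \<Rightarrow> 'a set \<Rightarrow> 'a set \<Rightarrow> bool" where
  "conjugate_decomposition V br J W1 W2 R1 I1 R2 I2 \<longleftrightarrow>
     direct_sum_of V W1 W2 \<and> J ` W1 \<subseteq> W1 \<and> J ` W2 \<subseteq> W2 \<and>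
     bracket_span br W1 W1 \<subseteq> W2 \<and> bracket_span br V W2 = {0} \<and>
     direct_sum_of W1 R1 I1 \<and> J ` R1 = I1 \<and>
     direct_sum_of W2 R2 I2 \<and> J ` R2 = I2"

definition conjugation_map ::
  "'a::real_vector set \<Rightarrow> 'a set \<Rightarrow> 'a set \<Rightarrow> 'a set \<Rightarrow> ('a \<Rightarrow> 'a) \<Rightarrow> bool" where
  "conjugation_map V R1 I1 W2 \<phi> \<longleftrightarrow>
     linear_endo V \<phi> \<and> (\<forall>x\<in>R1. \<phi> x = x) \<and> (\<forall>x\<in>I1. \<phi> x = - x) \<and> (\<forall>x\<in>W2. \<phi> x = x)"

definition conjugate_bracket ::
  "('a \<Rightarrow> 'a) \<Rightarrow> ('a \<Rightarrow> 'a \<Rightarrow> 'a) \<Rightarrow> 'a \<Rightarrow> 'a \<Rightarrow> 'a" where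
  "conjugate_bracket \<phi> br x y = br (\<phi> x) (\<phi> y)"

end

theory Submission
  imports Defs
begin

text \<open>
  If \<open>J\<close> is compatible with the bracket up to a sign, \<open>[JX, Y] = \<plusminus>J[X, Y]\<close>, then the Ricci operator
  commutes with \<open>J\<close>, so it coincides with its \<open>(1,1)\<close>-component; this gives (i) iff (ii) and (iv) iff (v).
  On a real form \<open>U\<close> orthogonal to \<open>J U\<close> the Ricci operator of \<open>V\<close> is twice that of \<open>U\<close>, and a
  derivation of \<open>U\<close> extends complex linearly to \<open>V\<close>, which gives (iii). Finally \<open>\<phi>\<close> fixes
  \<open>[V, V]\<close> pointwise and is isometric for orthogonal decompositions, so it is an isometric isomorphism
  between the conjugate algebra and \<open>V\<close>, and being a nilsoliton carries over.
\<close>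

section \<open>Linear maps and linear forms relative to a subspace\<close>

lemma linear_endoD:
  assumes "linear_endo V f"
  shows "x \<in> V \<Longrightarrow> f x \<in> V"
    and "x \<in> V \<Longrightarrow> y \<in> V \<Longrightarrow> f (x + y) = f x + f y"
    and "x \<in> V \<Longrightarrow> f (c *\<^sub>R x) = c *\<^sub>R f x"
  using assms by (auto simp: linear_endo_def)

lemma linear_endo_zero:
  assumes "linear_endo V f" "subspace V"
  shows "f 0 = 0"
  using linear_endoD(3)[OF assms(1), of 0 0] subspace_0[OF assms(2)] by simp

lemma linear_endo_minus:
  assumes "linear_endo V f" "x \<in> V"
  shows "f (- x) = - f x"
  using linear_endoD(3)[OF assms, of "-1"] by simp

lemma linear_endo_sum:
  assumes f: "linear_endo V f" and V: "subspace V" and h: "\<And>i. i \<in> A \<Longrightarrow> h i \<in> V"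
  shows "f (\<Sum>i\<in>A. h i) = (\<Sum>i\<in>A. f (h i))"
  using h
proof (induction A rule: infinite_finite_induct)
  case (insert i A)
  have "(\<Sum>i\<in>A. h i) \<in> V" using insert.prems by (intro subspace_sum[OF V]) auto
  then show ?case using insert linear_endoD(2)[OF f, of "h i" "\<Sum>i\<in>A. h i"] by simp
qed (simp_all add: linear_endo_zero[OF f V])

text \<open>Linearity is relative to \<open>V\<close>, since brackets and inner products are
  constrained only there.\<close>

definition linear_form_on :: "'a::real_vector set \<Rightarrow> ('a \<Rightarrow> real) \<Rightarrow> bool" where
  "linear_form_on V \<alpha> \<longleftrightarrow>
     (\<forall>x\<in>V. \<forall>y\<in>V. \<alpha> (x + y) = \<alpha> x + \<alpha> y) \<and> (\<forall>c. \<forall>x\<in>V. \<alpha> (c *\<^sub>R x) = c * \<alpha> x)"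

lemma linear_form_on_add:
  "linear_form_on V \<alpha> \<Longrightarrow> linear_form_on V \<beta> \<Longrightarrow> linear_form_on V (\<lambda>x. \<alpha> x + \<beta> x)"
  by (auto simp: linear_form_on_def algebra_simps)

lemma linear_form_on_cmult: "linear_form_on V \<alpha> \<Longrightarrow> linear_form_on V (\<lambda>x. c * \<alpha> x)"
  by (auto simp: linear_form_on_def algebra_simps)

lemma linear_form_on_sums:
  "(\<And>i. i \<in> A \<Longrightarrow> linear_form_on V (\<alpha> i)) \<Longrightarrow> linear_form_on V (\<lambda>x. \<Sum>i\<in>A. \<alpha> i x)"
  by (auto simp: linear_form_on_def sum.distrib sum_distrib_left cong: sum.cong)

lemma linear_form_on_sum:
  assumes \<alpha>: "linear_form_on V \<alpha>" and V: "subspace V" and h: "\<And>i. i \<in> A \<Longrightarrow> h i \<in> V"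
  shows "\<alpha> (\<Sum>i\<in>A. c i *\<^sub>R h i) = (\<Sum>i\<in>A. c i * \<alpha> (h i))"
  using h
proof (induction A rule: infinite_finite_induct)
  case (infinite A)
  have "\<alpha> (0 *\<^sub>R 0) = 0 * \<alpha> 0" using \<alpha> subspace_0[OF V] unfolding linear_form_on_def by blast
  then show ?case using infinite by simp
next
  case empty
  have "\<alpha> (0 *\<^sub>R 0) = 0 * \<alpha> 0" using \<alpha> subspace_0[OF V] unfolding linear_form_on_def by blast
  then show ?case by simp
next
  case (insert i A)
  have "(\<Sum>i\<in>A. c i *\<^sub>R h i) \<in> V"
    using insert.prems by (intro subspace_sum[OF V] subspace_scale[OF V]) auto
  moreover have "c i *\<^sub>R h i \<in> V" "h i \<in> V"
    using insert.prems by (auto intro: subspace_scale[OF V])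
  ultimately show ?case using insert \<alpha> unfolding linear_form_on_def by auto
qed

section \<open>Orthonormal bases, antisymmetry and direct sums\<close>

lemma onbD:
  assumes "orthonormal_basis_of V g B"
  shows "finite B" "span B = V" "b \<in> B \<Longrightarrow> b \<in> V"
    and "a \<in> B \<Longrightarrow> b \<in> B \<Longrightarrow> g a b = (if a = b then 1 else 0)"
  using assms span_superset[of B] by (auto simp: orthonormal_basis_of_def)

lemma sum_onb_delta:
  assumes "orthonormal_basis_of V g B" "b \<in> B"
  shows "(\<Sum>a\<in>B. f a * g a b) = f b"
proof -
  have "(\<Sum>a\<in>B. f a * g a b) = (\<Sum>a\<in>B. if a = b then f a else 0)"
    using onbD(4)[OF assms(1)] assms(2) by (intro sum.cong) auto
  then show ?thesis using onbD(1)[OF assms(1)] assms(2) by simp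
qed

text \<open>Polarization of \<open>br x x = 0\<close>: expanding \<open>br (x + y) (x + y)\<close>
  leaves only the two mixed brackets.\<close>

lemma lie_bracket_antisym:
  assumes L: "lie_algebra_on V br" and x: "x \<in> V" and y: "y \<in> V"
  shows "br y x = - br x y"
proof -
  have xy: "x + y \<in> V" using L x y by (simp add: lie_algebra_on_def subspace_add)
  have l: "linear_endo V (\<lambda>z. br z (x + y))" using L xy unfolding lie_algebra_on_def by blast
  have r: "linear_endo V (br x)" "linear_endo V (br y)" and "br (x + y) (x + y) = 0"
    and "br x x = 0" "br y y = 0"
    using L x y xy by (simp_all add: lie_algebra_on_def)
  then have "br y x + br x y = 0"
    using linear_endoD(2)[OF l x y] linear_endoD(2)[OF r(1) x y] linear_endoD(2)[OF r(2) x y]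
    by (simp add: add.commute)
  then show ?thesis by (simp add: eq_neg_iff_add_eq_0)
qed

lemma direct_sum_subset:
  assumes "direct_sum_of V A B"
  shows "A \<subseteq> V" "B \<subseteq> V"
proof -
  have V: "V = {a + b | a b. a \<in> A \<and> b \<in> B}" and 0: "0 \<in> A" "0 \<in> B"
    using assms subspace_0 by (auto simp: direct_sum_of_def)
  have "a + 0 \<in> V" if "a \<in> A" for a unfolding V using that 0 by blast
  then show "A \<subseteq> V" by auto
  have "0 + b \<in> V" if "b \<in> B" for b unfolding V using that 0 by blast
  then show "B \<subseteq> V" by auto
qed

lemma direct_sum_cases:
  assumes "direct_sum_of V A B" "x \<in> V"
  obtains a b where "a \<in> A" "b \<in> B" "x = a + b"
  using assms by (auto simp: direct_sum_of_def)

section \<open>Gram-Schmidt, orthonormal expansion and Parseval\<close>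

text \<open>The locale is interpreted later on \<open>V\<close>, on a real form \<open>U\<close> and
  on \<open>V\<close> with a second bracket, so that Ricci operators of several algebras can be
  compared inside one proof.\<close>

locale metric_lie_algebra =
  fixes V :: "'a::real_vector set" and br :: "'a \<Rightarrow> 'a \<Rightarrow> 'a" and g :: "'a \<Rightarrow> 'a \<Rightarrow> real"
  assumes lie: "lie_algebra_on V br" and ip: "inner_product_on V g"
begin

lemma subspace_V: "subspace V"
  using lie by (simp add: lie_algebra_on_def)

lemmas V_closed = subspace_0[OF subspace_V] subspace_add[OF subspace_V]
  subspace_scale[OF subspace_V] subspace_diff[OF subspace_V] subspace_neg[OF subspace_V]

lemma br_right: "x \<in> V \<Longrightarrow> linear_endo V (br x)"
  using lie by (simp add: lie_algebra_on_def)

lemma br_left: "y \<in> V \<Longrightarrow> linear_endo V (\<lambda>x. br x y)"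
  using lie by (simp add: lie_algebra_on_def)

lemma br_closed: "x \<in> V \<Longrightarrow> y \<in> V \<Longrightarrow> br x y \<in> V"
  using br_right linear_endoD(1) by blast

lemma g_sym: "x \<in> V \<Longrightarrow> y \<in> V \<Longrightarrow> g x y = g y x"
  using ip by (simp add: inner_product_on_def)

lemma g_add: "x \<in> V \<Longrightarrow> y \<in> V \<Longrightarrow> z \<in> V \<Longrightarrow> g (x + y) z = g x z + g y z"
  using ip by (simp add: inner_product_on_def)

lemma g_scale: "x \<in> V \<Longrightarrow> y \<in> V \<Longrightarrow> g (c *\<^sub>R x) y = c * g x y"
  using ip by (simp add: inner_product_on_def)

lemma g_add2: "x \<in> V \<Longrightarrow> y \<in> V \<Longrightarrow> z \<in> V \<Longrightarrow> g z (x + y) = g z x + g z y"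
  using g_sym g_add V_closed(2) by metis

lemma g_scale2: "x \<in> V \<Longrightarrow> y \<in> V \<Longrightarrow> g y (c *\<^sub>R x) = c * g y x"
  using g_sym g_scale V_closed(3) by metis

lemma g_minus: "x \<in> V \<Longrightarrow> y \<in> V \<Longrightarrow> g (- x) y = - g x y"
  using g_scale[of x y "-1"] by simp

lemma g_minus2: "x \<in> V \<Longrightarrow> y \<in> V \<Longrightarrow> g y (- x) = - g y x"
  using g_scale2[of x y "-1"] by simp

lemma g_diff: "x \<in> V \<Longrightarrow> y \<in> V \<Longrightarrow> z \<in> V \<Longrightarrow> g (x - y) z = g x z - g y z"
  using g_add[of x "- y" z] g_minus[of y z] V_closed(5)[of y] by simp

lemma g_linear_left: "y \<in> V \<Longrightarrow> linear_form_on V (\<lambda>x. g x y)"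
  by (simp add: linear_form_on_def g_add g_scale)

lemma g_sum:
  assumes "\<And>i. i \<in> A \<Longrightarrow> h i \<in> V" "y \<in> V"
  shows "g (\<Sum>i\<in>A. c i *\<^sub>R h i) y = (\<Sum>i\<in>A. c i * g (h i) y)"
  using linear_form_on_sum[OF g_linear_left[OF assms(2)] subspace_V, of A h c] assms by simp

lemma g_eq_zero:
  assumes "x \<in> V" "g x x = 0"
  shows "x = 0"
  using ip assms unfolding inner_product_on_def by force

lemma onb_subset_sum:
  assumes "\<And>b. b \<in> B \<Longrightarrow> b \<in> V"
  shows "(\<Sum>b\<in>B. c b *\<^sub>R b) \<in> V"
  by (intro subspace_sum[OF subspace_V] V_closed(3) assms)

text \<open>The induction runs over an arbitrary finite set, so the new vector may depend on the
  earlier ones; the case \<open>r = 0\<close> covers this.\<close>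

lemma gram_schmidt:
  assumes "finite S" "S \<subseteq> V"
  shows "\<exists>B. orthonormal_basis_of (span S) g B"
  using assms
proof (induction S rule: finite_induct)
  case empty
  have "orthonormal_basis_of (span {}) g {}" by (simp add: orthonormal_basis_of_def)
  then show ?case by blast
next
  case (insert s S)
  then obtain B where B: "orthonormal_basis_of (span S) g B" by auto
  have s: "s \<in> V" and S: "S \<subseteq> V" using insert.prems by auto
  have BV: "b \<in> V" if "b \<in> B" for b
    using onbD(3)[OF B that] span_minimal[OF S subspace_V] by blast
  \<comment> \<open>\<open>p\<close> is the orthogonal projection of \<open>s\<close> to the span of
    \<open>B\<close>, and \<open>r\<close> is the remaining orthogonal component.\<close>
  define p where "p = (\<Sum>b\<in>B. g s b *\<^sub>R b)"
  define r where "r = s - p"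
  have pV: "p \<in> V" unfolding p_def by (rule onb_subset_sum[OF BV])
  have rV: "r \<in> V" unfolding r_def using s pV by (rule V_closed(4))
  have p_span: "p \<in> span B"
    unfolding p_def by (intro span_sum span_scale span_base)
  have rb: "g r b = 0" if "b \<in> B" for b
    using sum_onb_delta[OF B that, of "g s"]
      g_sum[where h = "\<lambda>b. b" and A = B and c = "g s", OF BV BV[OF that]]
    g_diff[OF s pV BV[OF that]]
    by (simp add: r_def p_def)
  have sp: "span (insert s S) = span (insert s B)"
    using onbD(2)[OF B] by (simp add: span_insert)
  show ?case
  proof (cases "r = 0")
    case True
    then have "s \<in> span B" using p_span by (simp add: r_def)
    then have "span (insert s B) = span S" using span_redundant onbD(2)[OF B] by blast
    then show ?thesis using B sp by auto
  next
    case False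
    define u where "u = (1 / sqrt (g r r)) *\<^sub>R r"
    have pos: "g r r > 0" using False rV ip by (simp add: inner_product_on_def)
    have uV: "u \<in> V" unfolding u_def by (intro V_closed rV)
    have uu: "g u u = 1"
      using pos rV uV by (simp add: u_def g_scale g_scale2 V_closed field_simps)
    have ub: "g u b = 0" "g b u = 0" if "b \<in> B" for b
      using rb[OF that] g_scale[OF rV BV[OF that]] g_sym[OF uV BV[OF that]] by (auto simp: u_def)
    have "span (insert u B) = span (insert s B)"
    proof -
      have "r = sqrt (g r r) *\<^sub>R u" using pos by (simp add: u_def)
      then have "s = sqrt (g r r) *\<^sub>R u + p" by (simp add: r_def)
      moreover have "p \<in> span (insert u B)" using p_span span_mono[of B "insert u B"] by blast
      ultimately have s1: "s \<in> span (insert u B)"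
        by (metis span_add span_scale span_base insertI1)
      have "p \<in> span (insert s B)" using p_span span_mono[of B "insert s B"] by blast
      then have "u \<in> span (insert s B)"
        unfolding u_def r_def by (intro span_scale span_diff) (auto intro: span_base)
      moreover have "B \<subseteq> span (insert s B)" "B \<subseteq> span (insert u B)" by (auto intro: span_base)
      ultimately show ?thesis using s1 by (intro span_eq[THEN iffD2]) auto
    qed
    moreover have "u \<notin> B" using ub(1) uu by fastforce
    ultimately have "orthonormal_basis_of (span (insert s S)) g (insert u B)"
      using onbD(1)[OF B] onbD(4)[OF B] ub uu sp by (auto simp: orthonormal_basis_of_def)
    then show ?thesis by blast
  qed
qed

lemma onb_exists: "\<exists>B. orthonormal_basis_of V g B"
proof -
  obtain S where "finite S" "V = span S" using lie by (auto simp: lie_algebra_on_def)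
  then show ?thesis using gram_schmidt[of S] span_superset[of S] by auto
qed

text \<open>The difference \<open>x - y\<close> is orthogonal to \<open>B\<close>, hence to the span
  of \<open>B\<close>, which contains it; positivity then forces it to vanish.\<close>

lemma onb_eqI:
  assumes B: "orthonormal_basis_of V g B" and x: "x \<in> V" and y: "y \<in> V"
    and eq: "\<And>b. b \<in> B \<Longrightarrow> g x b = g y b"
  shows "x = y"
proof -
  define z where "z = x - y"
  have z: "z \<in> V" using x y by (simp add: z_def V_closed)
  have "B \<subseteq> {w \<in> V. g w z = 0}"
  proof
    fix b assume b: "b \<in> B"
    have bV: "b \<in> V" using onbD(3)[OF B b] .
    have "g z b = 0" using eq[OF b] x y bV by (simp add: z_def g_diff)
    then show "b \<in> {w \<in> V. g w z = 0}" using bV g_sym[OF z bV] by simp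
  qed
  moreover have "subspace {w \<in> V. g w z = 0}"
    unfolding subspace_def using z g_scale[OF V_closed(1) z, of 0]
    by (auto simp: V_closed g_add g_scale)
  ultimately have "span B \<subseteq> {w \<in> V. g w z = 0}" by (rule span_minimal)
  then have "g z z = 0" using onbD(2)[OF B] z by blast
  then show ?thesis using g_eq_zero[OF z] by (simp add: z_def)
qed

lemma onb_expansion:
  assumes B: "orthonormal_basis_of V g B" and x: "x \<in> V"
  shows "(\<Sum>b\<in>B. g x b *\<^sub>R b) = x"
proof (rule onb_eqI[OF B _ x])
  show "(\<Sum>b\<in>B. g x b *\<^sub>R b) \<in> V" by (rule onb_subset_sum) (rule onbD(3)[OF B])
next
  fix b assume "b \<in> B"
  then show "g (\<Sum>b\<in>B. g x b *\<^sub>R b) b = g x b"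
    using g_sum[where h = "\<lambda>b. b" and A = B and c = "g x", OF onbD(3)[OF B] onbD(3)[OF B]]
      sum_onb_delta[OF B] by simp
qed

lemma parseval:
  assumes B: "orthonormal_basis_of V g B" and x: "x \<in> V" and y: "y \<in> V"
  shows "(\<Sum>b\<in>B. g x b * g y b) = g x y"
proof -
  have "g x y = g (\<Sum>b\<in>B. g x b *\<^sub>R b) y" using onb_expansion[OF B x] by simp
  also have "\<dots> = (\<Sum>b\<in>B. g x b * g b y)" using onbD(3)[OF B] y by (simp add: g_sum)
  also have "\<dots> = (\<Sum>b\<in>B. g x b * g y b)"
    using onbD(3)[OF B] y by (intro sum.cong) (auto simp: g_sym)
  finally show ?thesis by simp
qed

section \<open>Basis independence and the Ricci operator\<close>

text \<open>The trace of a bilinear form with respect to \<open>g\<close>. Expand both slots in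
  \<open>C\<close>; by Parseval, the coefficient of \<open>\<beta> c d\<close> summed over
  \<open>B\<close> is \<open>g c d\<close>, so only the diagonal survives. The sums in
  \<open>ricci_form\<close> are such traces in each index separately.\<close>

lemma trace_independent:
  assumes B: "orthonormal_basis_of V g B" and C: "orthonormal_basis_of V g C"
    and l: "\<And>y. y \<in> V \<Longrightarrow> linear_form_on V (\<lambda>x. \<beta> x y)"
    and r: "\<And>x. x \<in> V \<Longrightarrow> linear_form_on V (\<beta> x)"
  shows "(\<Sum>a\<in>B. \<beta> a a) = (\<Sum>c\<in>C. \<beta> c c)"
proof -
  note BV = onbD(3)[OF B] and CV = onbD(3)[OF C]
  have "\<beta> a a = (\<Sum>c\<in>C. \<Sum>d\<in>C. (g c a * g d a) * \<beta> c d)" if a: "a \<in> B" for a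
  proof -
    have "\<beta> a a = (\<Sum>c\<in>C. g a c * \<beta> c a)"
      using linear_form_on_sum[OF l[OF BV[OF a]] subspace_V CV, of C "\<lambda>x. x" "g a"]
      by (simp add: onb_expansion[OF C BV[OF a]])
    also have "\<dots> = (\<Sum>c\<in>C. g a c * (\<Sum>d\<in>C. g a d * \<beta> c d))"
    proof (intro sum.cong refl arg_cong2[where f = "(*)"])
      fix c assume "c \<in> C"
      then show "\<beta> c a = (\<Sum>d\<in>C. g a d * \<beta> c d)"
        using linear_form_on_sum[OF r[OF CV] subspace_V CV, of c C "\<lambda>x. x" "g a"]
        by (simp add: onb_expansion[OF C BV[OF a]])
    qed
    finally show ?thesis
      using g_sym[OF BV[OF a] CV] by (simp add: sum_distrib_left mult.assoc cong: sum.cong)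
  qed
  then have "(\<Sum>a\<in>B. \<beta> a a) = (\<Sum>a\<in>B. \<Sum>c\<in>C. \<Sum>d\<in>C. (g c a * g d a) * \<beta> c d)"
    by (rule sum.cong[OF refl])
  also have "\<dots> = (\<Sum>c\<in>C. \<Sum>a\<in>B. \<Sum>d\<in>C. (g c a * g d a) * \<beta> c d)"
    by (rule sum.swap)
  also have "\<dots> = (\<Sum>c\<in>C. \<Sum>d\<in>C. (\<Sum>a\<in>B. g c a * g d a) * \<beta> c d)"
    by (subst sum.swap) (simp add: sum_distrib_right)
  also have "\<dots> = (\<Sum>c\<in>C. \<Sum>d\<in>C. \<beta> c d * g d c)"
    using CV by (intro sum.cong refl) (simp add: parseval[OF B] g_sym)
  also have "\<dots> = (\<Sum>c\<in>C. \<beta> c c)" by (simp add: sum_onb_delta[OF C])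
  finally show ?thesis .
qed

lemma ricci_form_parseval:
  assumes B: "orthonormal_basis_of V g B" and "x \<in> V" "y \<in> V"
  shows "ricci_form B br g x y =
    - (1/2) * (\<Sum>a\<in>B. g (br x a) (br y a)) + (1/4) * (\<Sum>a\<in>B. \<Sum>b\<in>B. g (br a b) x * g (br a b) y)"
  using assms by (simp add: ricci_form_def parseval[OF B] br_closed onbD(3)[OF B])

text \<open>The two indices are changed one at a time, each by \<open>trace_independent\<close>.
  They may range over different bases, because \<open>ricci_commutes_complex\<close> rotates only
  one of them by \<open>J\<close>.\<close>

lemma bracket_trace_independent:
  assumes B: "orthonormal_basis_of V g B" and C: "orthonormal_basis_of V g C"
    and C': "orthonormal_basis_of V g C'" and B': "orthonormal_basis_of V g B'"
    and x: "x \<in> V" and y: "y \<in> V"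
  shows "(\<Sum>a\<in>B. \<Sum>b\<in>B'. g (br a b) x * g (br a b) y) =
         (\<Sum>a\<in>C. \<Sum>b\<in>C'. g (br a b) x * g (br a b) y)"
proof -
  note lin = linear_endoD[OF br_left] linear_endoD[OF br_right]
  have "(\<Sum>b\<in>B'. g (br a b) x * g (br a b) y) = (\<Sum>b\<in>C'. g (br a b) x * g (br a b) y)"
    if a: "a \<in> V" for a
    using trace_independent[OF B' C', of "\<lambda>b c. g (br a b) x * g (br a c) y"] a x y
    by (auto simp: linear_form_on_def lin g_add g_scale br_closed V_closed algebra_simps)
  then have "(\<Sum>a\<in>B. \<Sum>b\<in>B'. g (br a b) x * g (br a b) y) =
             (\<Sum>a\<in>B. \<Sum>b\<in>C'. g (br a b) x * g (br a b) y)"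
    using onbD(3)[OF B] by (intro sum.cong[OF refl]) auto
  also have "\<dots> = (\<Sum>b\<in>C'. \<Sum>a\<in>B. g (br a b) x * g (br a b) y)" by (rule sum.swap)
  also have "\<dots> = (\<Sum>b\<in>C'. \<Sum>a\<in>C. g (br a b) x * g (br a b) y)"
  proof (rule sum.cong[OF refl])
    fix b assume "b \<in> C'"
    then have b: "b \<in> V" using onbD(3)[OF C'] by blast
    show "(\<Sum>a\<in>B. g (br a b) x * g (br a b) y) = (\<Sum>a\<in>C. g (br a b) x * g (br a b) y)"
      using trace_independent[OF B C, of "\<lambda>a c. g (br a b) x * g (br c b) y"] b x y
      by (auto simp: linear_form_on_def lin g_add g_scale br_closed V_closed algebra_simps)
  qed
  also have "\<dots> = (\<Sum>a\<in>C. \<Sum>b\<in>C'. g (br a b) x * g (br a b) y)" by (rule sum.swap)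
  finally show ?thesis .
qed

lemma ricci_form_independent:
  assumes B: "orthonormal_basis_of V g B" and C: "orthonormal_basis_of V g C"
    and x: "x \<in> V" and y: "y \<in> V"
  shows "ricci_form B br g x y = ricci_form C br g x y"
proof -
  note lin = linear_endoD[OF br_right]
  have "(\<Sum>a\<in>B. g (br x a) (br y a)) = (\<Sum>a\<in>C. g (br x a) (br y a))"
    using trace_independent[OF B C, of "\<lambda>a b. g (br x a) (br y b)"] x y
    by (auto simp: linear_form_on_def lin g_add g_scale g_add2 g_scale2 br_closed V_closed)
  then show ?thesis
    using bracket_trace_independent[OF B C C B x y] x y
    by (simp add: ricci_form_parseval[OF B] ricci_form_parseval[OF C])
qed

lemma ricci_form_linear:
  assumes B: "orthonormal_basis_of V g B"
  shows "x \<in> V \<Longrightarrow> linear_form_on V (ricci_form B br g x)"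
    and "y \<in> V \<Longrightarrow> linear_form_on V (\<lambda>x. ricci_form B br g x y)"
proof -
  note BV = onbD(3)[OF B]
  show *: "linear_form_on V (ricci_form B br g x)" if "x \<in> V" for x
    unfolding ricci_form_def using BV
    by (intro linear_form_on_add linear_form_on_cmult linear_form_on_sums)
       (auto simp: linear_form_on_def linear_endoD[OF br_left] g_add g_scale g_add2 g_scale2 br_closed)
  have "(\<lambda>x. ricci_form B br g x y) = ricci_form B br g y" for y
    by (simp add: fun_eq_iff ricci_form_def mult.commute)
  then show "y \<in> V \<Longrightarrow> linear_form_on V (\<lambda>x. ricci_form B br g x y)" using * by simp
qed

text \<open>Justifies the definite description in \<open>ricci\<close>. Existence is Riesz
  representation in one orthonormal basis, valid for every other basis by independence; uniqueness
  is \<open>onb_eqI\<close>, applied to a basis that exists by Gram-Schmidt.\<close>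

lemma ricci_characterization:
  assumes x: "x \<in> V"
  shows "ricci V br g x \<in> V \<and> (\<forall>B. orthonormal_basis_of V g B \<longrightarrow>
           (\<forall>y\<in>V. g (ricci V br g x) y = ricci_form B br g x y))"
  unfolding ricci_def
proof (rule theI')
  obtain C where C: "orthonormal_basis_of V g C" using onb_exists by blast
  \<comment> \<open>The coefficients are forced by testing the required identity against the members
    of \<open>C\<close>.\<close>
  define r where "r = (\<Sum>c\<in>C. ricci_form C br g x c *\<^sub>R c)"
  have r: "r \<in> V" unfolding r_def by (rule onb_subset_sum) (rule onbD(3)[OF C])
  have "g r y = ricci_form B br g x y" if B: "orthonormal_basis_of V g B" and y: "y \<in> V" for B y
  proof -
    have "g r y = (\<Sum>c\<in>C. g y c * ricci_form C br g x c)"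
      unfolding r_def using onbD(3)[OF C] y by (simp add: g_sum g_sym mult.commute cong: sum.cong)
    also have "\<dots> = ricci_form C br g x (\<Sum>c\<in>C. g y c *\<^sub>R c)"
      using linear_form_on_sum[OF ricci_form_linear(1)[OF C x] subspace_V, of C "\<lambda>c. c"]
        onbD(3)[OF C] by simp
    finally show ?thesis
      using onb_expansion[OF C y] ricci_form_independent[OF B C x y] by simp
  qed
  then have r_form: "r \<in> V \<and> (\<forall>B. orthonormal_basis_of V g B \<longrightarrow>
           (\<forall>y\<in>V. g r y = ricci_form B br g x y))" using r by blast
  show "\<exists>!r. r \<in> V \<and> (\<forall>B. orthonormal_basis_of V g B \<longrightarrow>
           (\<forall>y\<in>V. g r y = ricci_form B br g x y))"
  proof (rule ex1I, rule r_form)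
    fix r'
    assume r': "r' \<in> V \<and> (\<forall>B. orthonormal_basis_of V g B \<longrightarrow>
           (\<forall>y\<in>V. g r' y = ricci_form B br g x y))"
    show "r' = r"
    proof (rule onb_eqI[OF C _ r])
      fix b assume "b \<in> C"
      then show "g r' b = g r b" using r' r_form C onbD(3)[OF C] by metis
    qed (use r' in blast)
  qed
qed

lemma ricci_closed: "x \<in> V \<Longrightarrow> ricci V br g x \<in> V"
  using ricci_characterization by blast

lemma g_ricci:
  assumes "orthonormal_basis_of V g B" "x \<in> V" "y \<in> V"
  shows "g (ricci V br g x) y = ricci_form B br g x y"
  using ricci_characterization assms by blast

text \<open>Ricci operators are identified below through this test, on a single orthonormal basis
  adapted to the situation.\<close>

lemma ricci_eqI:
  assumes "orthonormal_basis_of V g B" "x \<in> V" "r \<in> V"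
    and "\<And>b. b \<in> B \<Longrightarrow> g r b = ricci_form B br g x b"
  shows "ricci V br g x = r"
  using onb_eqI[OF assms(1) ricci_closed[OF assms(2)] assms(3)] g_ricci[OF assms(1,2)]
    assms(4) onbD(3)[OF assms(1)] by simp

lemma ricci_linear: "linear_endo V (ricci V br g)"
proof -
  obtain B where B: "orthonormal_basis_of V g B" using onb_exists by blast
  have "ricci V br g (x + y) = ricci V br g x + ricci V br g y" if "x \<in> V" "y \<in> V" for x y
    using that ricci_form_linear(2)[OF B] onbD(3)[OF B]
    by (intro ricci_eqI[OF B])
       (auto simp: V_closed ricci_closed g_add g_ricci[OF B] linear_form_on_def)
  moreover have "ricci V br g (c *\<^sub>R x) = c *\<^sub>R ricci V br g x" if "x \<in> V" for c x
    using that ricci_form_linear(2)[OF B] onbD(3)[OF B]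
    by (intro ricci_eqI[OF B])
       (auto simp: V_closed ricci_closed g_scale g_ricci[OF B] linear_form_on_def)
  ultimately show ?thesis by (simp add: linear_endo_def ricci_closed)
qed

text \<open>Expanding a preimage shows that the images span. Distinct basis vectors cannot share an
  image, since their inner product 0 would become 1; injectivity is recorded for reindexing sums
  over the image basis.\<close>

lemma onb_image:
  assumes B: "orthonormal_basis_of V g B" and f: "linear_endo V f" "f ` V = V"
    and iso: "\<And>x y. x \<in> V \<Longrightarrow> y \<in> V \<Longrightarrow> g (f x) (f y) = g x y"
  shows "orthonormal_basis_of V g (f ` B)" and "inj_on f B"
proof -
  note BV = onbD(3)[OF B]
  show inj: "inj_on f B"
    by (rule inj_onI) (metis BV iso onbD(4)[OF B] zero_neq_one)
  have "V \<subseteq> span (f ` B)"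
  proof
    fix y assume "y \<in> V"
    then obtain x where x: "x \<in> V" "y = f x" using f(2) by blast
    have "y = (\<Sum>b\<in>B. f (g x b *\<^sub>R b))"
      using linear_endo_sum[OF f(1) subspace_V, of B "\<lambda>b. g x b *\<^sub>R b"] BV x(2)
      by (simp add: V_closed onb_expansion[OF B x(1)])
    also have "\<dots> = (\<Sum>b\<in>B. g x b *\<^sub>R f b)"
      using BV by (intro sum.cong refl linear_endoD(3)[OF f(1)])
    finally show "y \<in> span (f ` B)"
      by (simp add: span_sum span_scale span_base)
  qed
  moreover have "span (f ` B) \<subseteq> V"
    using BV linear_endoD(1)[OF f(1)] by (intro span_minimal[OF _ subspace_V]) auto
  ultimately show "orthonormal_basis_of V g (f ` B)"
    using inj onbD(1)[OF B] onbD(4)[OF B] BV iso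
    by (auto simp: orthonormal_basis_of_def inj_on_eq_iff)
qed

end

section \<open>Complex structures compatible with the bracket up to sign\<close>

lemma almost_complex_onto:
  assumes "almost_complex_on V J" "subspace V"
  shows "J ` V = V"
proof
  have J: "linear_endo V J" and JJ: "\<And>x. x \<in> V \<Longrightarrow> J (J x) = - x"
    using assms(1) by (auto simp: almost_complex_on_def)
  show "J ` V \<subseteq> V" using linear_endoD(1)[OF J] by blast
  show "V \<subseteq> J ` V"
  proof
    fix x assume x: "x \<in> V"
    then have "x = J (J (- x))" "J (- x) \<in> V"
      using JJ[of "- x"] subspace_neg[OF assms(2)] linear_endoD(1)[OF J] by auto
    then show "x \<in> J ` V" by blast
  qed
qed

text \<open>The sign \<open>\<epsilon>\<close> covers bi-invariant structures and those of conjugate algebras at once.\<close>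

lemma (in metric_lie_algebra) ricci_commutes_complex:
  assumes J: "almost_complex_on V J" and H: "hermitian_metric V J g"
    and anti: "\<And>x y. x \<in> V \<Longrightarrow> y \<in> V \<Longrightarrow> br (J x) y = \<epsilon> *\<^sub>R J (br x y)"
    and eps: "\<epsilon> * \<epsilon> = 1" and x: "x \<in> V"
  shows "ricci V br g (J x) = J (ricci V br g x)"
proof -
  have lin: "linear_endo V J" and JJ: "\<And>x. x \<in> V \<Longrightarrow> J (J x) = - x"
    using J by (auto simp: almost_complex_on_def)
  note JV = linear_endoD(1)[OF lin]
  have iso: "g (J x) (J y) = g x y" if "x \<in> V" "y \<in> V" for x y
    using H that by (simp add: hermitian_metric_def)
  \<comment> \<open>An orthogonal \<open>J\<close> with square \<open>- I\<close> is
    skew-adjoint.\<close>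
  have skew: "g u (J v) = - g (J u) v" if "u \<in> V" "v \<in> V" for u v
    using iso[of u "J v"] that by (simp add: JJ JV g_minus2)
  obtain B where B: "orthonormal_basis_of V g B" using onb_exists by blast
  note BV = onbD(3)[OF B]
  note JB = onb_image[OF B lin almost_complex_onto[OF J subspace_V] iso]
  have eps2: "\<epsilon> * (\<epsilon> * t) = t" for t :: real using eps by (simp add: mult.assoc[symmetric])
  \<comment> \<open>In the first sum both signs and both \<open>J\<close> cancel. In the second,
    \<open>J\<close> passes from \<open>x\<close> and \<open>y\<close> to the index
    \<open>a\<close>, which merely replaces the basis of that index by its image under
    \<open>J\<close>.\<close>
  have inv: "ricci_form B br g (J x) (J y) = ricci_form B br g x y" if y: "y \<in> V" for y
  proof -
    have "(\<Sum>a\<in>B. g (br (J x) a) (br (J y) a)) = (\<Sum>a\<in>B. g (br x a) (br y a))"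
      using BV x y
      by (intro sum.cong refl) (simp add: anti g_scale g_scale2 br_closed JV V_closed iso eps2)
    moreover have "(\<Sum>a\<in>B. \<Sum>b\<in>B. g (br a b) (J x) * g (br a b) (J y)) =
        (\<Sum>a\<in>B. \<Sum>b\<in>B. g (br (J a) b) x * g (br (J a) b) y)"
      using BV x y
      by (intro sum.cong refl) (simp add: anti g_scale br_closed JV skew mult.assoc mult.left_commute eps2)
    moreover have "\<dots> = (\<Sum>a\<in>J ` B. \<Sum>b\<in>B. g (br a b) x * g (br a b) y)"
      by (simp add: sum.reindex[OF JB(2)])
    moreover have "\<dots> = (\<Sum>a\<in>B. \<Sum>b\<in>B. g (br a b) x * g (br a b) y)"
      by (rule bracket_trace_independent[OF JB(1) B B B x y])
    ultimately show ?thesis using x y JV by (simp add: ricci_form_parseval[OF B])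
  qed
  show ?thesis
  proof (rule ricci_eqI[OF B JV[OF x] JV[OF ricci_closed[OF x]]])
    fix b assume b: "b \<in> B"
    have bV: "b \<in> V" using BV b .
    \<comment> \<open>\<open>- J b\<close> is the preimage of \<open>b\<close> under
      \<open>J\<close>; writing \<open>b\<close> as its image lets orthogonality of \<open>J\<close>
      apply.\<close>
    have nb: "- J b \<in> V" "J (- J b) = b"
      using bV by (auto simp: JV V_closed linear_endo_minus[OF lin] JJ)
    have "g (J (ricci V br g x)) b = g (ricci V br g x) (- J b)"
      using iso[of "ricci V br g x" "- J b"] nb ricci_closed[OF x] by simp
    also have "\<dots> = ricci_form B br g x (- J b)" by (rule g_ricci[OF B x nb(1)])
    also have "\<dots> = ricci_form B br g (J x) b" using inv[OF nb(1)] nb(2) by simp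
    finally show "g (J (ricci V br g x)) b = ricci_form B br g (J x) b" .
  qed
qed

text \<open>Since Ric commutes with \<open>J\<close>, the operator \<open>J\<close> Ric
  \<open>J\<close> equals - Ric, so \<open>ricciJ\<close> and \<open>ricci\<close> agree on
  \<open>V\<close> and the two conditions ask for the same \<open>c\<close> and \<open>D\<close>.
  Both include nilpotency, which settles the other case.\<close>

lemma minimal_iff_nilsoliton:
  assumes J: "almost_complex_on V J" and H: "hermitian_metric V J g"
    and anti: "\<And>x y. x \<in> V \<Longrightarrow> y \<in> V \<Longrightarrow> br (J x) y = \<epsilon> *\<^sub>R J (br x y)"
    and eps: "\<epsilon> * \<epsilon> = 1"
  shows "minimal_metric V br J g \<longleftrightarrow> nilsoliton V br g"
proof (cases "nilpotent_lie_algebra V br")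
  case True
  then interpret metric_lie_algebra V br g
    using H by unfold_locales (simp_all add: nilpotent_lie_algebra_def hermitian_metric_def)
  have "ricciJ V br J g x = ricci V br g x" if x: "x \<in> V" for x
  proof -
    have "J (ricci V br g (J x)) = - ricci V br g x"
      using ricci_commutes_complex[OF J H anti eps x] ricci_closed[OF x] J
      by (simp add: almost_complex_on_def)
    then show ?thesis by (simp add: ricciJ_def scaleR_2[symmetric])
  qed
  then show ?thesis
    using True J H ip by (simp add: minimal_metric_def nilsoliton_def cong: ball_cong)
qed (simp add: minimal_metric_def nilsoliton_def)

section \<open>Transport along isometric isomorphisms\<close>

text \<open>\<open>f\<close> is an isometric isomorphism from the algebra with bracket
  \<open>br'\<close> to the one with \<open>br\<close>. Evaluated in the image basis, every term of
  the Ricci form of \<open>br\<close> is the corresponding term for \<open>br'\<close>.\<close>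

lemma ricci_isometry:
  assumes M: "metric_lie_algebra V br g" and M': "metric_lie_algebra V br' g"
    and f: "linear_endo V f" "f ` V = V"
    and iso: "\<And>x y. x \<in> V \<Longrightarrow> y \<in> V \<Longrightarrow> g (f x) (f y) = g x y"
    and hom: "\<And>x y. x \<in> V \<Longrightarrow> y \<in> V \<Longrightarrow> f (br' x y) = br (f x) (f y)"
    and x: "x \<in> V"
  shows "ricci V br g (f x) = f (ricci V br' g x)"
proof -
  interpret M: metric_lie_algebra V br g by (rule M)
  interpret M': metric_lie_algebra V br' g by (rule M')
  note fV = linear_endoD(1)[OF f(1)]
  obtain B where B: "orthonormal_basis_of V g B" using M.onb_exists by blast
  note BV = onbD(3)[OF B]
  note fB = M.onb_image[OF B f iso]
  show ?thesis
  proof (rule M.ricci_eqI[OF fB(1) fV[OF x] fV[OF M'.ricci_closed[OF x]]])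
    fix c assume "c \<in> f ` B"
    then obtain b where b: "b \<in> B" "c = f b" by blast
    have "ricci_form (f ` B) br g (f x) (f b) = ricci_form B br' g x b"
      unfolding ricci_form_def using BV x b(1)
      by (simp add: sum.reindex[OF fB(2)] hom[symmetric] iso M'.br_closed)
    then show "g (f (ricci V br' g x)) c = ricci_form (f ` B) br g (f x) c"
      using M'.g_ricci[OF B x BV[OF b(1)]] iso[OF M'.ricci_closed[OF x] BV[OF b(1)]] b(2) by simp
  qed
qed

text \<open>The constant \<open>c\<close> is kept and \<open>D\<close> is conjugated by
  \<open>f\<close>. As \<open>f\<close> is its own inverse, the conjugate is \<open>f D f\<close>,
  and the lemma can be applied in either direction between the two brackets.\<close>

lemma nilsoliton_involution:
  assumes N: "nilpotent_lie_algebra V br" and N': "nilpotent_lie_algebra V br'"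
    and ip: "inner_product_on V g"
    and f: "linear_endo V f" "\<And>x. x \<in> V \<Longrightarrow> f (f x) = x"
    and iso: "\<And>x y. x \<in> V \<Longrightarrow> y \<in> V \<Longrightarrow> g (f x) (f y) = g x y"
    and hom: "\<And>x y. x \<in> V \<Longrightarrow> y \<in> V \<Longrightarrow> f (br' x y) = br (f x) (f y)"
    and S: "nilsoliton V br g"
  shows "nilsoliton V br' g"
proof -
  interpret M: metric_lie_algebra V br g
    using N ip by unfold_locales (simp_all add: nilpotent_lie_algebra_def)
  interpret M': metric_lie_algebra V br' g
    using N' ip by unfold_locales (simp_all add: nilpotent_lie_algebra_def)
  note fV = linear_endoD(1)[OF f(1)]
  have onto: "f ` V = V" using fV f(2) by (metis image_eqI subsetI subset_antisym image_subsetI)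
  obtain c D where D: "derivation_on V br D" "\<And>x. x \<in> V \<Longrightarrow> ricci V br g x = c *\<^sub>R x + D x"
    using S by (auto simp: nilsoliton_def)
  have linD: "linear_endo V D" and DD: "\<And>x y. x \<in> V \<Longrightarrow> y \<in> V \<Longrightarrow> D (br x y) = br (D x) y + br x (D y)"
    using D(1) by (auto simp: derivation_on_def)
  note DV = linear_endoD(1)[OF linD]
  have hom': "br' x y = f (br (f x) (f y))" if "x \<in> V" "y \<in> V" for x y
    using hom[OF that] f(2)[OF M'.br_closed[OF that]] by simp
  have "linear_endo V (\<lambda>x. f (D (f x)))"
    using fV DV linear_endoD[OF f(1)] linear_endoD[OF linD] by (simp add: linear_endo_def)
  then have "derivation_on V br' (\<lambda>x. f (D (f x)))"
    using fV DV f(2) M.br_closed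
    by (simp add: derivation_on_def hom' DD linear_endoD(2)[OF f(1)])
  moreover have "ricci V br' g x = c *\<^sub>R x + f (D (f x))" if x: "x \<in> V" for x
  proof -
    have "ricci V br g (f x) = f (ricci V br' g x)"
      by (rule ricci_isometry[OF M.metric_lie_algebra_axioms M'.metric_lie_algebra_axioms f(1) onto])
        (simp_all add: iso hom x)
    then have "ricci V br' g x = f (ricci V br g (f x))"
      using f(2)[OF M'.ricci_closed[OF x]] by simp
    also have "\<dots> = f (c *\<^sub>R f x) + f (D (f x))"
      using x by (simp only: D(2) fV DV M.V_closed linear_endoD(2)[OF f(1)])
    also have "f (c *\<^sub>R f x) = c *\<^sub>R x"
      using x by (simp only: fV f(2) linear_endoD(3)[OF f(1)])
    finally show ?thesis .
  qed
  ultimately show ?thesis using N' ip by (auto simp: nilsoliton_def)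
qed

section \<open>Complexification of a real form\<close>

text \<open>\<open>bi_invariant_complex\<close> speaks of the first argument; antisymmetry carries
  it to the second.\<close>

lemma bi_invariant_right:
  assumes L: "lie_algebra_on V br" and J: "bi_invariant_complex V br J" and x: "x \<in> V" and y: "y \<in> V"
  shows "br x (J y) = J (br x y)"
proof -
  note antisym = lie_bracket_antisym[OF L]
  have lin: "linear_endo V J" and inv: "br (J y) x = J (br y x)"
    using J x y by (auto simp: bi_invariant_complex_def almost_complex_on_def)
  have "br x y \<in> V" using L x y by (simp add: lie_algebra_on_def linear_endo_def)
  then show ?thesis
    using inv antisym[OF x linear_endoD(1)[OF lin y]] antisym[OF x y] linear_endo_minus[OF lin]
    by simp
qed

lemma complexification_subset:
  assumes "complexification_of V br J U"
  shows "U \<subseteq> V"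
  using assms direct_sum_subset unfolding complexification_of_def by blast

lemma complexification_cases:
  assumes "complexification_of V br J U" "x \<in> V"
  obtains a b where "a \<in> U" "b \<in> U" "x = a + J b"
  using assms direct_sum_cases unfolding complexification_of_def by blast

text \<open>
  An orthonormal basis \<open>B\<close> of \<open>U\<close> yields the orthonormal basis \<open>B \<union> J ` B\<close> of \<open>V\<close>; the factor 2
  arises since half of the terms in each sum vanish and the others come in equal pairs.
\<close>

lemma ricci_complexification:
  assumes M: "metric_lie_algebra V br g" and J: "bi_invariant_complex V br J"
    and H: "hermitian_metric V J g" and U: "complexification_of V br J U"
    and orth: "orthogonal_sets g U (J ` U)" and x: "x \<in> U"
  shows "ricci V br g x = 2 *\<^sub>R ricci U br g x"
proof -
  interpret M: metric_lie_algebra V br g by (rule M)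
  have UV: "u \<in> V" if "u \<in> U" for u using complexification_subset[OF U] that by blast
  interpret N: metric_lie_algebra U br g
    using U M.ip UV by unfold_locales (auto simp: complexification_of_def inner_product_on_def)
  have lin: "linear_endo V J" and JJ: "\<And>x. x \<in> V \<Longrightarrow> J (J x) = - x"
    and left: "\<And>x y. x \<in> V \<Longrightarrow> y \<in> V \<Longrightarrow> br (J x) y = J (br x y)"
    using J by (auto simp: bi_invariant_complex_def almost_complex_on_def)
  note right = bi_invariant_right[OF M.lie J]
  note JV = linear_endoD(1)[OF lin]
  have iso: "g (J x) (J y) = g x y" if "x \<in> V" "y \<in> V" for x y
    using H that by (simp add: hermitian_metric_def)
  have o1: "g u (J v) = 0" if "u \<in> U" "v \<in> U" for u v
    using orth that by (auto simp: orthogonal_sets_def)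
  have o2: "g (J v) u = 0" if "u \<in> U" "v \<in> U" for u v
    using o1[OF that] M.g_sym[of u "J v"] that UV JV by simp
  obtain B where B: "orthonormal_basis_of U g B" using N.onb_exists by blast
  note BU = onbD(3)[OF B]
  have BV: "b \<in> V" if "b \<in> B" for b using UV BU that by blast
  have inj: "inj_on J B"
    by (rule inj_onI) (metis BV iso onbD(4)[OF B] zero_neq_one)
  \<comment> \<open>A common vector would lie in \<open>U\<close> and in its image under
    \<open>J\<close>, hence be orthogonal to itself.\<close>
  have disj: "B \<inter> J ` B = {}"
  proof (rule ccontr)
    assume "B \<inter> J ` B \<noteq> {}"
    then obtain b where b: "b \<in> B" "J b \<in> B" by blast
    then have "g (J b) (J b) = 0" using o1[OF BU BU] by blast
    then show False using onbD(4)[OF B b(2) b(2)] by simp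
  qed
  have C: "orthonormal_basis_of V g (B \<union> J ` B)"
  proof -
    have "span (B \<union> J ` B) \<subseteq> V"
      using BV JV by (intro span_minimal[OF _ M.subspace_V]) auto
    moreover have "V \<subseteq> span (B \<union> J ` B)"
    proof
      fix v assume "v \<in> V"
      then obtain a b where ab: "a \<in> U" "b \<in> U" "v = a + J b" using complexification_cases[OF U] by blast
      have a: "a \<in> span (B \<union> J ` B)"
        using ab(1) onbD(2)[OF B] span_mono[of B "B \<union> J ` B"] by blast
      have "J b = (\<Sum>c\<in>B. J (g b c *\<^sub>R c))"
        using linear_endo_sum[OF lin M.subspace_V, of B "\<lambda>c. g b c *\<^sub>R c"] BV
        by (simp add: M.V_closed N.onb_expansion[OF B ab(2)])
      also have "\<dots> = (\<Sum>c\<in>B. g b c *\<^sub>R J c)"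
        using BV by (intro sum.cong refl linear_endoD(3)[OF lin])
      finally have "J b \<in> span (B \<union> J ` B)"
        by (simp add: span_sum span_scale span_base)
      then show "v \<in> span (B \<union> J ` B)" using a ab(3) span_add by blast
    qed
    ultimately show ?thesis
      using onbD(1)[OF B] onbD(4)[OF B] BU BV o1 o2 iso inj disj
      by (auto simp: orthonormal_basis_of_def inj_on_eq_iff)
  qed
  have split: "(\<Sum>c\<in>B \<union> J ` B. h c) = (\<Sum>c\<in>B. h c + h (J c))" for h :: "'a \<Rightarrow> real"
    using onbD(1)[OF B] disj by (simp add: sum.union_disjoint sum.reindex[OF inj] sum.distrib)
  note simps = left right JJ M.br_closed JV UV BU BV N.br_closed o1 o2 iso M.g_minus M.g_minus2
  have "ricci_form (B \<union> J ` B) br g x b = 2 * ricci_form B br g x b" if b: "b \<in> B" for b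
    using x b
    by (simp add: M.ricci_form_parseval[OF C] N.ricci_form_parseval[OF B] split simps
        sum.distrib sum_distrib_left algebra_simps cong: sum.cong)
  \<comment> \<open>Brackets of basis vectors lie in \<open>U\<close> or in its image under
    \<open>J\<close>, so each term contains an inner product between these two orthogonal spaces.
    Thus Ric maps \<open>U\<close> to itself.\<close>
  moreover have "ricci_form (B \<union> J ` B) br g x (J b) = 0" if b: "b \<in> B" for b
    using x b
    by (simp add: M.ricci_form_parseval[OF C] split simps cong: sum.cong)
  ultimately show ?thesis
    using x UV N.ricci_closed[OF x] BU BV
    by (intro M.ricci_eqI[OF C])
       (auto simp: M.V_closed M.g_scale JV o1 N.g_ricci[OF B x])
qed

lemma lower_central_mono:
  assumes "U \<subseteq> V"
  shows "lower_central U br k \<subseteq> lower_central V br k"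
proof (induction k)
  case (Suc k)
  then show ?case using assms by (auto simp: bracket_span_def intro!: span_mono)
qed (simp add: assms)

text \<open>The lower central series of \<open>U\<close> lies in that of \<open>V\<close>;
  membership of 0 turns inclusion in \<open>{0}\<close> into equality.\<close>

lemma nilpotent_subalgebra:
  assumes "nilpotent_lie_algebra V br" "lie_algebra_on U br" "U \<subseteq> V"
  shows "nilpotent_lie_algebra U br"
proof -
  obtain k where "lower_central V br k = {0}" using assms(1) by (auto simp: nilpotent_lie_algebra_def)
  moreover have "0 \<in> lower_central U br k"
    using assms(2) by (cases k) (auto simp: bracket_span_def span_zero lie_algebra_on_def subspace_0)
  ultimately have "lower_central U br k = {0}" using lower_central_mono[OF assms(3), of br k] by blast
  then show ?thesis using assms(2) by (auto simp: nilpotent_lie_algebra_def)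
qed

text \<open>By the factor 2 between the Ricci operators, \<open>c\<close> and \<open>D\<close> on
  \<open>V\<close> correspond to half of each on \<open>U\<close>. Restriction works because Ric,
  and so \<open>D\<close>, preserves \<open>U\<close>.\<close>

lemma nilsoliton_complexification:
  assumes nil: "nilpotent_lie_algebra V br" and J: "bi_invariant_complex V br J"
    and H: "hermitian_metric V J g" and U: "complexification_of V br J U"
    and orth: "orthogonal_sets g U (J ` U)"
  shows "nilsoliton V br g \<longleftrightarrow> nilsoliton U br g"
proof -
  interpret M: metric_lie_algebra V br g
    using nil H by unfold_locales (simp_all add: nilpotent_lie_algebra_def hermitian_metric_def)
  have UV: "u \<in> V" if "u \<in> U" for u using complexification_subset[OF U] that by blast
  have lieU: "lie_algebra_on U br" using U by (simp add: complexification_of_def)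
  have ipU: "inner_product_on U g" using M.ip UV by (simp add: inner_product_on_def)
  interpret N: metric_lie_algebra U br g by unfold_locales (rule lieU ipU)+
  have ac: "almost_complex_on V J" and left: "\<And>x y. x \<in> V \<Longrightarrow> y \<in> V \<Longrightarrow> br (J x) y = J (br x y)"
    using J by (auto simp: bi_invariant_complex_def)
  then have lin: "linear_endo V J" by (simp add: almost_complex_on_def)
  note right = bi_invariant_right[OF M.lie J]
  note JV = linear_endoD(1)[OF lin]
  note ric = ricci_complexification[OF M.metric_lie_algebra_axioms J H U orth]
  show ?thesis
  proof
    assume "nilsoliton V br g"
    then obtain c D where D: "derivation_on V br D" "\<And>x. x \<in> V \<Longrightarrow> ricci V br g x = c *\<^sub>R x + D x"
      by (auto simp: nilsoliton_def)
    then have linD: "linear_endo V D"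
      and DD: "\<And>x y. x \<in> V \<Longrightarrow> y \<in> V \<Longrightarrow> D (br x y) = br (D x) y + br x (D y)"
      by (auto simp: derivation_on_def)
    have DU: "D x \<in> U" if x: "x \<in> U" for x
    proof -
      have "D x = 2 *\<^sub>R ricci U br g x - c *\<^sub>R x" using D(2)[OF UV[OF x]] ric[OF x] by simp
      then show ?thesis using x N.ricci_closed N.V_closed by metis
    qed
    have "derivation_on U br (\<lambda>x. (1/2) *\<^sub>R D x)"
      using DU UV linear_endoD[OF linD]
      by (simp add: derivation_on_def linear_endo_def N.V_closed DD scaleR_add_right
          linear_endoD(3)[OF N.br_left] linear_endoD(3)[OF N.br_right])
    moreover have "ricci U br g x = (c/2) *\<^sub>R x + (1/2) *\<^sub>R D x" if x: "x \<in> U" for x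
    proof -
      have "ricci U br g x = (1/2) *\<^sub>R ricci V br g x" by (simp add: ric[OF x])
      then show ?thesis by (simp add: D(2)[OF UV[OF x]] scaleR_add_right)
    qed
    ultimately show "nilsoliton U br g"
      using nilpotent_subalgebra[OF nil lieU complexification_subset[OF U]] ipU
      unfolding nilsoliton_def by blast
  next
    assume "nilsoliton U br g"
    then obtain c D where D: "derivation_on U br D" "\<And>x. x \<in> U \<Longrightarrow> ricci U br g x = c *\<^sub>R x + D x"
      by (auto simp: nilsoliton_def)
    then have DU: "\<And>x. x \<in> U \<Longrightarrow> D x \<in> U"
      and DD: "\<And>x y. x \<in> U \<Longrightarrow> y \<in> U \<Longrightarrow> D (br x y) = br (D x) y + br x (D y)"
      by (auto simp: derivation_on_def linear_endo_def)
    \<comment> \<open>The only possible derivation for the constant \<open>2 * c\<close>. It is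
      already linear on \<open>V\<close>, commutes with \<open>J\<close> and equals
      \<open>2 D\<close> on \<open>U\<close>, so it is the complex linear extension of
      \<open>2 D\<close>.\<close>
    define E where "E x = ricci V br g x - (2 * c) *\<^sub>R x" for x
    have linE: "linear_endo V E"
      using linear_endoD[OF M.ricci_linear]
      by (auto simp: linear_endo_def E_def M.V_closed algebra_simps)
    note EV = linear_endoD(1)[OF linE] and Eadd = linear_endoD(2)[OF linE]
    have EU: "E x = 2 *\<^sub>R D x" if "x \<in> U" for x
      using that by (simp add: E_def ric D(2) scaleR_add_right)
    have EJ: "E (J x) = J (E x)" if x: "x \<in> V" for x
    proof -
      have "J (ricci V br g x + - ((2 * c) *\<^sub>R x)) = J (ricci V br g x) + - ((2 * c) *\<^sub>R J x)"
        using x by (simp only: linear_endoD[OF lin] linear_endo_minus[OF lin] M.V_closed M.ricci_closed)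
      then show ?thesis
        using M.ricci_commutes_complex[OF ac H, of 1] left x by (simp add: E_def)
    qed
    \<comment> \<open>The derivation identity for one pair. It holds on \<open>U\<close> and
      survives \<open>J\<close> and sums in each argument, which reaches all of
      \<open>V\<close>.\<close>
    define P where "P x y \<longleftrightarrow> E (br x y) = br (E x) y + br x (E y)" for x y
    have PU: "P x y" if "x \<in> U" "y \<in> U" for x y
      using that DU UV
      by (simp add: P_def EU DD N.br_closed scaleR_add_right
          linear_endoD(3)[OF N.br_left] linear_endoD(3)[OF N.br_right])
    have PJl: "P (J x) y" if "x \<in> V" "y \<in> V" "P x y" for x y
      using that by (simp add: P_def left EJ EV M.br_closed linear_endoD(2)[OF lin])
    have PJr: "P x (J y)" if "x \<in> V" "y \<in> V" "P x y" for x y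
      using that by (simp add: P_def right EJ EV M.br_closed linear_endoD(2)[OF lin])
    have Pal: "P (x + x') y" if "x \<in> V" "x' \<in> V" "y \<in> V" "P x y" "P x' y" for x x' y
      using that by (simp add: P_def Eadd EV M.br_closed linear_endoD(2)[OF M.br_left] M.V_closed)
    have Par: "P x (y + y')" if "x \<in> V" "y \<in> V" "y' \<in> V" "P x y" "P x y'" for x y y'
      using that by (simp add: P_def Eadd EV M.br_closed linear_endoD(2)[OF M.br_right] M.V_closed)
    have "P x y" if xy: "x \<in> V" "y \<in> V" for x y
    proof -
      obtain a b where x: "a \<in> U" "b \<in> U" "x = a + J b" using complexification_cases[OF U xy(1)] .
      obtain c d where y: "c \<in> U" "d \<in> U" "y = c + J d" using complexification_cases[OF U xy(2)] .
      have "P u y" if "u \<in> U" for u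
        unfolding y(3) using that y(1,2) by (blast intro: Par PJr PU UV JV)
      then show ?thesis
        unfolding x(3) using x(1,2) xy(2) by (blast intro: Pal PJl UV JV)
    qed
    then have "derivation_on V br E" using linE by (simp add: derivation_on_def P_def)
    moreover have "ricci V br g x = (2 * c) *\<^sub>R x + E x" for x by (simp add: E_def)
    ultimately show "nilsoliton V br g"
      using nil M.ip unfolding nilsoliton_def by blast
  qed
qed

section \<open>The conjugate of a 2-step nilpotent algebra\<close>

locale conjugate_setup =
  fixes V :: "'a::real_vector set" and br J W1 W2 R1 I1 R2 I2 \<phi>
  assumes lie: "lie_algebra_on V br"
    and J: "bi_invariant_complex V br J"
    and dec: "conjugate_decomposition V br J W1 W2 R1 I1 R2 I2"
    and map: "conjugation_map V R1 I1 W2 \<phi>"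
begin

lemma lin_\<phi>: "linear_endo V \<phi>"
  using map by (simp add: conjugation_map_def)

lemma lin_J: "linear_endo V J"
  using J by (simp add: bi_invariant_complex_def almost_complex_on_def)

lemma subspace_V: "subspace V"
  using lie by (simp add: lie_algebra_on_def)

lemma sums: "direct_sum_of V W1 W2" "direct_sum_of W1 R1 I1"
  using dec by (auto simp: conjugate_decomposition_def)

lemma subspaces: "subspace W2" "subspace R1" "subspace I1"
  using sums by (auto simp: direct_sum_of_def)

lemmas W_subset = direct_sum_subset[OF sums(1)]
lemmas R1_I1_subset = direct_sum_subset[OF sums(2)]

lemma parts_V: "r \<in> R1 \<Longrightarrow> r \<in> V" "i \<in> I1 \<Longrightarrow> i \<in> V" "w \<in> W2 \<Longrightarrow> w \<in> V"
  using W_subset R1_I1_subset by auto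

lemma V_cases:
  assumes "x \<in> V"
  obtains r i w where "r \<in> R1" "i \<in> I1" "w \<in> W2" "x = r + i + w"
  using assms direct_sum_cases[OF sums(1)] direct_sum_cases[OF sums(2)] by metis

lemma \<phi>_parts:
  assumes "r \<in> R1" "i \<in> I1" "w \<in> W2"
  shows "\<phi> (r + i + w) = r + - i + w"
  using assms parts_V subspace_add[OF subspace_V] map
  by (simp add: linear_endoD(2)[OF lin_\<phi>] conjugation_map_def)

lemma \<phi>_W2: "w \<in> W2 \<Longrightarrow> \<phi> w = w"
  using map by (simp add: conjugation_map_def)

lemma \<phi>_involution:
  assumes "x \<in> V"
  shows "\<phi> (\<phi> x) = x"
proof -
  obtain r i w where "r \<in> R1" "i \<in> I1" "w \<in> W2" "x = r + i + w" using V_cases[OF assms] .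
  then show ?thesis using \<phi>_parts[of r i w] \<phi>_parts[of r "- i" w] subspace_neg[OF subspaces(3)] by simp
qed

lemma central_W2:
  assumes "x \<in> V" "w \<in> W2"
  shows "br x w = 0"
proof -
  have "br x w \<in> bracket_span br V W2"
    using assms by (auto simp: bracket_span_def intro!: span_base)
  then show ?thesis using dec by (simp add: conjugate_decomposition_def)
qed

lemma central_W2':
  assumes "x \<in> V" "w \<in> W2"
  shows "br w x = 0"
  using lie_bracket_antisym[OF lie assms(1) parts_V(3)[OF assms(2)]] central_W2[OF assms] by simp

text \<open>The \<open>W2\<close> components are central, so the bracket only sees the
  \<open>W1\<close> components. This is why \<open>\<phi>\<close> fixes every bracket.\<close>

lemma bracket_W2:
  assumes "x \<in> V" "y \<in> V"
  shows "br x y \<in> W2"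
proof -
  obtain a b where x: "a \<in> W1" "b \<in> W2" "x = a + b" using direct_sum_cases[OF sums(1) assms(1)] .
  obtain c d where y: "c \<in> W1" "d \<in> W2" "y = c + d" using direct_sum_cases[OF sums(1) assms(2)] .
  have aV: "a \<in> V" "b \<in> V" "c \<in> V" "d \<in> V" using x y W_subset by auto
  have l: "linear_endo V (\<lambda>x. br x y)" and r: "linear_endo V (br a)"
    using lie assms aV by (auto simp: lie_algebra_on_def)
  have "br x y = br a y" using linear_endoD(2)[OF l aV(1,2)] central_W2'[OF assms(2) x(2)] x(3) by simp
  also have "\<dots> = br a c" using linear_endoD(2)[OF r aV(3,4)] central_W2[OF aV(1) y(2)] y(3) by simp
  also have "\<dots> \<in> bracket_span br W1 W1"
    using x(1) y(1) by (auto simp: bracket_span_def intro!: span_base)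
  finally show ?thesis using dec by (auto simp: conjugate_decomposition_def)
qed

text \<open>\<open>J\<close> exchanges \<open>R1\<close> and \<open>I1\<close>, so
  \<open>\<phi>\<close> anticommutes with \<open>J\<close> on \<open>W1\<close>; the
  \<open>W2\<close> components drop out of the bracket by centrality.\<close>

lemma conjugate_anti_invariant:
  assumes x: "x \<in> V" and y: "y \<in> V"
  shows "conjugate_bracket \<phi> br (J x) y = - J (conjugate_bracket \<phi> br x y)"
proof -
  obtain r i w where d: "r \<in> R1" "i \<in> I1" "w \<in> W2" "x = r + i + w" using V_cases[OF x] .
  have JJ: "J (J v) = - v" if "v \<in> V" for v
    using J that by (simp add: bi_invariant_complex_def almost_complex_on_def)
  have left: "br (J u) v = J (br u v)" if "u \<in> V" "v \<in> V" for u v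
    using J that by (simp add: bi_invariant_complex_def)
  have JRI: "J ` R1 = I1" and JW: "J ` W2 \<subseteq> W2"
    using dec by (auto simp: conjugate_decomposition_def)
  have Jr: "J r \<in> I1" and Jw: "J w \<in> W2" using JRI JW d by auto
  obtain s where s: "s \<in> R1" "i = J s" using d(2) JRI by blast
  have Ji: "J i \<in> R1" using s JJ[OF parts_V(1)[OF s(1)]] subspace_neg[OF subspaces(2)] by simp
  have V: "r \<in> V" "i \<in> V" "w \<in> V" using d parts_V by auto
  note JV = linear_endoD(1)[OF lin_J]
  note cl = subspace_add[OF subspace_V] subspace_neg[OF subspace_V]
  have "J x = J i + J r + J w"
    using V cl by (simp add: d(4) linear_endoD(2)[OF lin_J] add.commute)
  then have \<phi>J: "\<phi> (J x) = J i + - J r + J w" using \<phi>_parts[OF Ji Jr Jw] by simp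
  define z where "z = \<phi> y"
  have z: "z \<in> V" using linear_endoD(1)[OF lin_\<phi> y] by (simp add: z_def)
  have l: "linear_endo V (\<lambda>x. br x z)" using lie z by (simp add: lie_algebra_on_def)
  have bV: "br u z \<in> V" if "u \<in> V" for u using linear_endoD(1)[OF l that] .
  have "br (\<phi> (J x)) z = J (br i z) + - J (br r z)"
    unfolding \<phi>J using V JV cl z central_W2'[OF z Jw]
    by (simp only: linear_endoD(2)[OF l] linear_endo_minus[OF l] left) simp
  moreover have "br (\<phi> x) z = br r z + - br i z"
    unfolding d(4) \<phi>_parts[OF d(1-3)] using V cl central_W2'[OF z d(3)]
    by (simp only: linear_endoD(2)[OF l] linear_endo_minus[OF l]) simp
  moreover have "J (br r z + - br i z) = J (br r z) + - J (br i z)"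
    using V bV cl by (simp only: linear_endoD(2)[OF lin_J] linear_endo_minus[OF lin_J])
  ultimately show ?thesis by (simp add: conjugate_bracket_def z_def)
qed

text \<open>\<open>\<phi>\<close> is an isomorphism onto the original algebra because it fixes
  brackets; the companion \<open>conjugate_hom'\<close> states the same for its inverse, again
  \<open>\<phi>\<close>.\<close>

lemma conjugate_hom:
  assumes "x \<in> V" "y \<in> V"
  shows "\<phi> (conjugate_bracket \<phi> br x y) = br (\<phi> x) (\<phi> y)"
  using assms linear_endoD(1)[OF lin_\<phi>] by (simp add: conjugate_bracket_def \<phi>_W2 bracket_W2)

lemma conjugate_hom':
  assumes "x \<in> V" "y \<in> V"
  shows "\<phi> (br x y) = conjugate_bracket \<phi> br (\<phi> x) (\<phi> y)"
  using assms by (simp add: conjugate_bracket_def \<phi>_W2 \<phi>_involution bracket_W2)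

text \<open>Conjugate brackets lie in \<open>W2\<close>, which \<open>\<phi>\<close> fixes and which
  is central, so all double brackets vanish. This gives 2-step nilpotency and makes each Jacobi term
  zero.\<close>

lemma conjugate_nilpotent: "nilpotent_lie_algebra V (conjugate_bracket \<phi> br)"
proof -
  let ?br = "conjugate_bracket \<phi> br"
  note \<phi>V = linear_endoD(1)[OF lin_\<phi>]
  have W2: "?br x y \<in> W2" if "x \<in> V" "y \<in> V" for x y
    using that bracket_W2 \<phi>V by (simp add: conjugate_bracket_def)
  have zero: "?br x w = 0" if "x \<in> V" "w \<in> W2" for x w
    using that central_W2 \<phi>V by (simp add: conjugate_bracket_def \<phi>_W2)
  have "linear_endo V (?br x)" "linear_endo V (\<lambda>y. ?br y x)" "?br x x = 0" if x: "x \<in> V" for x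
  proof -
    have r: "linear_endo V (br (\<phi> x))" and l: "linear_endo V (\<lambda>y. br y (\<phi> x))"
      using lie \<phi>V[OF x] by (auto simp: lie_algebra_on_def)
    show "linear_endo V (?br x)" "linear_endo V (\<lambda>y. ?br y x)"
      using linear_endoD[OF r] linear_endoD[OF l] linear_endoD[OF lin_\<phi>]
      by (simp_all add: linear_endo_def conjugate_bracket_def)
    show "?br x x = 0" using lie \<phi>V[OF x] by (simp add: lie_algebra_on_def conjugate_bracket_def)
  qed
  then have L: "lie_algebra_on V ?br"
    using lie W2 zero by (simp add: lie_algebra_on_def)
  have "bracket_span ?br V V \<subseteq> W2"
    unfolding bracket_span_def using W2 by (intro span_minimal subspaces(1)) auto
  then have "{?br x y | x y. x \<in> V \<and> y \<in> bracket_span ?br V V} \<subseteq> {0}"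
    using zero by blast
  then have "lower_central V ?br (Suc (Suc 0)) \<subseteq> {0}"
    by (simp add: bracket_span_def span_minimal)
  moreover have "0 \<in> lower_central V ?br (Suc (Suc 0))"
    by (simp add: bracket_span_def span_zero)
  ultimately have "lower_central V ?br (Suc (Suc 0)) = {0}" by blast
  then show ?thesis using L unfolding nilpotent_lie_algebra_def by blast
qed

text \<open>The \<open>R1\<close>, \<open>I1\<close> and \<open>W2\<close> components are mutually
  orthogonal, and \<open>\<phi>\<close> acts on each by a sign.\<close>

lemma \<phi>_isometry:
  assumes ip: "inner_product_on V g"
    and oW: "orthogonal_sets g W1 W2" and oR: "orthogonal_sets g R1 I1"
    and x: "x \<in> V" and y: "y \<in> V"
  shows "g (\<phi> x) (\<phi> y) = g x y"
proof -
  interpret metric_lie_algebra V br g using lie ip by unfold_locales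
  obtain r i w where d: "r \<in> R1" "i \<in> I1" "w \<in> W2" "x = r + i + w" using V_cases[OF x] .
  obtain r' i' w' where e: "r' \<in> R1" "i' \<in> I1" "w' \<in> W2" "y = r' + i' + w'" using V_cases[OF y] .
  have V: "r \<in> V" "i \<in> V" "w \<in> V" "r' \<in> V" "i' \<in> V" "w' \<in> V" using d e parts_V by auto
  have o: "g r i' = 0" "g r' i = 0" "g r w' = 0" "g i w' = 0" "g r' w = 0" "g i' w = 0"
    using d e oW oR R1_I1_subset by (auto simp: orthogonal_sets_def)
  then have o': "g i' r = 0" "g i r' = 0" "g w' r = 0" "g w' i = 0" "g w r' = 0" "g w i' = 0"
    using V g_sym by metis+
  show ?thesis
    unfolding d(4) e(4) \<phi>_parts[OF d(1-3)] \<phi>_parts[OF e(1-3)]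
    using V o o' by (simp add: g_add g_add2 g_minus g_minus2 V_closed del: add_uminus_conv_diff)
qed

end

text \<open>The equivalences (i)-(ii) and (iv)-(v) are stated for every admissible choice. Links
  with \<open>U\<close> or between the two brackets are stated for orthogonal decompositions:
  \<open>g\<close> is then determined by its restriction to \<open>U\<close>, and
  \<open>\<phi>\<close> is an isometry.\<close>

theorem proposition4p7:
  fixes V :: "'a::real_vector set" and br :: "'a \<Rightarrow> 'a \<Rightarrow> 'a"
    and J :: "'a \<Rightarrow> 'a" and g :: "'a \<Rightarrow> 'a \<Rightarrow> real" and n :: nat
  assumes "nilpotent_lie_algebra V br"
    and "dim V = 2 * n"
    and "bi_invariant_complex V br J"
    and "hermitian_metric V J g"
  shows
    "(minimal_metric V br J g \<longleftrightarrow> nilsoliton V br g) \<and>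
     (\<forall>U. complexification_of V br J U \<and> dim U = n \<and> orthogonal_sets g U (J ` U) \<longrightarrow>
        (minimal_metric V br J g \<longleftrightarrow> nilsoliton U br g) \<and>
        (nilsoliton V br g \<longleftrightarrow> nilsoliton U br g)) \<and>
     (two_step_nilpotent V br \<longrightarrow>
        (\<forall>W1 W2 R1 I1 R2 I2 \<phi>.
           conjugate_decomposition V br J W1 W2 R1 I1 R2 I2 \<and> conjugation_map V R1 I1 W2 \<phi> \<longrightarrow>
             (minimal_metric V (conjugate_bracket \<phi> br) J g \<longleftrightarrow>
                nilsoliton V (conjugate_bracket \<phi> br) g) \<and>
             (orthogonal_sets g W1 W2 \<and> orthogonal_sets g R1 I1 \<longrightarrow>
                (minimal_metric V br J g \<longleftrightarrow> minimal_metric V (conjugate_bracket \<phi> br) J g) \<and>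
                (nilsoliton V br g \<longleftrightarrow> nilsoliton V (conjugate_bracket \<phi> br) g) \<and>
                (\<forall>U. complexification_of V br J U \<and> dim U = n \<and>
                     orthogonal_sets g U (J ` U) \<longrightarrow>
                   (nilsoliton U br g \<longleftrightarrow>
                      minimal_metric V (conjugate_bracket \<phi> br) J g) \<and>
                   (nilsoliton U br g \<longleftrightarrow>
                      nilsoliton V (conjugate_bracket \<phi> br) g)))))"
proof -
  have lie: "lie_algebra_on V br" and ip: "inner_product_on V g"
    and ac: "almost_complex_on V J"
    using assms by (auto simp: nilpotent_lie_algebra_def hermitian_metric_def bi_invariant_complex_def)
  have i_ii: "minimal_metric V br J g \<longleftrightarrow> nilsoliton V br g"
    using assms(3) by (intro minimal_iff_nilsoliton[OF ac assms(4), where \<epsilon> = 1])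
      (simp_all add: bi_invariant_complex_def)
  have ii_iii: "nilsoliton V br g \<longleftrightarrow> nilsoliton U br g"
    if "complexification_of V br J U \<and> dim U = n \<and> orthogonal_sets g U (J ` U)" for U
    using that nilsoliton_complexification[OF assms(1,3,4)] by blast
  have conj: "(minimal_metric V (conjugate_bracket \<phi> br) J g \<longleftrightarrow>
        nilsoliton V (conjugate_bracket \<phi> br) g) \<and>
      (orthogonal_sets g W1 W2 \<and> orthogonal_sets g R1 I1 \<longrightarrow>
        (nilsoliton V br g \<longleftrightarrow> nilsoliton V (conjugate_bracket \<phi> br) g))"
    if d: "conjugate_decomposition V br J W1 W2 R1 I1 R2 I2 \<and> conjugation_map V R1 I1 W2 \<phi>"
    for W1 W2 R1 I1 R2 I2 \<phi>
  proof -
    interpret conjugate_setup V br J W1 W2 R1 I1 R2 I2 \<phi>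
      using lie assms(3) d by unfold_locales auto
    have "minimal_metric V (conjugate_bracket \<phi> br) J g \<longleftrightarrow>
        nilsoliton V (conjugate_bracket \<phi> br) g"
      by (intro minimal_iff_nilsoliton[OF ac assms(4), where \<epsilon> = "-1"])
        (simp_all add: conjugate_anti_invariant)
    moreover have "nilsoliton V br g \<longleftrightarrow> nilsoliton V (conjugate_bracket \<phi> br) g"
      if o: "orthogonal_sets g W1 W2" "orthogonal_sets g R1 I1"
    proof
      note iso = \<phi>_isometry[OF ip o]
      show "nilsoliton V (conjugate_bracket \<phi> br) g" if "nilsoliton V br g"
        by (rule nilsoliton_involution[OF assms(1) conjugate_nilpotent ip lin_\<phi>])
          (simp_all add: \<phi>_involution iso conjugate_hom that)
      \<comment> \<open>The same transport with the two brackets exchanged, as \<open>\<phi>\<close>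
        is an involution.\<close>
      show "nilsoliton V br g" if "nilsoliton V (conjugate_bracket \<phi> br) g"
        by (rule nilsoliton_involution[OF conjugate_nilpotent assms(1) ip lin_\<phi>])
          (simp_all add: \<phi>_involution iso conjugate_hom' that)
    qed
    ultimately show ?thesis by blast
  qed
  show ?thesis
    using i_ii ii_iii conj by (intro conjI allI impI) (blast+)
qed

end
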